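(* Let $n$ be a positive integer. Then, as rings: (i) if $n$ is odd, $\mathbb{H}(\mathbb{Z}/n\mathbb{Z})\cong\mathbb{L}(\mathbb{Z}/n\mathbb{Z})\cong\mathbb{M}_2(\mathbb{Z}/n\mathbb{Z})$; (ii) if $n\equiv 2\pmod 4$, $\mathbb{H}(\mathbb{Z}/n\mathbb{Z})\cong\mathbb{L}(\mathbb{Z}/n\mathbb{Z})\not\cong\mathbb{M}_2(\mathbb{Z}/n\mathbb{Z})$; (iii) if $n\equiv 0\pmod 4$, the rings $\mathbb{H}(\mathbb{Z}/n\mathbb{Z})$, $\mathbb{L}(\mathbb{Z}/n\mathbb{Z})$ and $\mathbb{M}_2(\mathbb{Z}/n\mathbb{Z})$ are pairwise non-isomorphic.
   Context: For a commutative associative ring $R$ with identity and units $a,b\in R$, the quaternion ring $\left(\frac{a,b}{R}\right)$ is the free $R$-module of rank $4$ with basis $\{1,i,j,k\}$, equipped with the associative, unital, $R$-bilinear multiplication determined by $i^2=a$, $j^2=b$, $ij=-ji=k$. Notation: $\mathbb{H}(R)=\left(\frac{-1,-1}{R}\right)$ and $\mathbb{L}(R)=\left(\frac{1,1}{R}\right)$. $\mathbb{M}_2(R)$ denotes the ring of $2\times 2$ matrices over $R$. *)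

theory Defs
  imports "HOL-Algebra.IntRing"
begin

text \<open>
  The tuple \<open>(x0, x1, x2, x3)\<close> stands for \<open>x0 + x1 i + x2 j + x3 k\<close>. The product is the bilinear
  extension of the multiplication table forced by associativity and
  \<open>i\<^sup>2 = a\<close>, \<open>j\<^sup>2 = b\<close>, \<open>i j = - j i = k\<close>, namely \<open>k\<^sup>2 = - a b\<close>, \<open>i k = - k i = a j\<close>,
  \<open>k j = - j k = b i\<close>. The lemmas below confirm that this is an associative unital ring satisfying
  the defining relations, with scalars central; the parameters \<open>a\<close> and \<open>b\<close> are meant to be units
  of a commutative ring.
\<close>

type_synonym 'a quat = "'a \<times> 'a \<times> 'a \<times> 'a"

definition quaternion_ring :: "('a, 'm) ring_scheme \<Rightarrow> 'a \<Rightarrow> 'a \<Rightarrow> 'a quat ring" where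
  "quaternion_ring R a b =
    \<lparr>carrier = carrier R \<times> carrier R \<times> carrier R \<times> carrier R,
     monoid.mult = (\<lambda>(x0, x1, x2, x3) (y0, y1, y2, y3).
       (x0 \<otimes>\<^bsub>R\<^esub> y0 \<oplus>\<^bsub>R\<^esub> a \<otimes>\<^bsub>R\<^esub> (x1 \<otimes>\<^bsub>R\<^esub> y1) \<oplus>\<^bsub>R\<^esub> b \<otimes>\<^bsub>R\<^esub> (x2 \<otimes>\<^bsub>R\<^esub> y2)
          \<ominus>\<^bsub>R\<^esub> a \<otimes>\<^bsub>R\<^esub> b \<otimes>\<^bsub>R\<^esub> (x3 \<otimes>\<^bsub>R\<^esub> y3),
        x0 \<otimes>\<^bsub>R\<^esub> y1 \<oplus>\<^bsub>R\<^esub> x1 \<otimes>\<^bsub>R\<^esub> y0 \<oplus>\<^bsub>R\<^esub> b \<otimes>\<^bsub>R\<^esub> (x3 \<otimes>\<^bsub>R\<^esub> y2) \<ominus>\<^bsub>R\<^esub> b \<otimes>\<^bsub>R\<^esub> (x2 \<otimes>\<^bsub>R\<^esub> y3),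
        x0 \<otimes>\<^bsub>R\<^esub> y2 \<oplus>\<^bsub>R\<^esub> x2 \<otimes>\<^bsub>R\<^esub> y0 \<oplus>\<^bsub>R\<^esub> a \<otimes>\<^bsub>R\<^esub> (x1 \<otimes>\<^bsub>R\<^esub> y3) \<ominus>\<^bsub>R\<^esub> a \<otimes>\<^bsub>R\<^esub> (x3 \<otimes>\<^bsub>R\<^esub> y1),
        x0 \<otimes>\<^bsub>R\<^esub> y3 \<oplus>\<^bsub>R\<^esub> x3 \<otimes>\<^bsub>R\<^esub> y0 \<oplus>\<^bsub>R\<^esub> x1 \<otimes>\<^bsub>R\<^esub> y2 \<ominus>\<^bsub>R\<^esub> x2 \<otimes>\<^bsub>R\<^esub> y1)),
     one = (\<one>\<^bsub>R\<^esub>, \<zero>\<^bsub>R\<^esub>, \<zero>\<^bsub>R\<^esub>, \<zero>\<^bsub>R\<^esub>),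
     zero = (\<zero>\<^bsub>R\<^esub>, \<zero>\<^bsub>R\<^esub>, \<zero>\<^bsub>R\<^esub>, \<zero>\<^bsub>R\<^esub>),
     add = (\<lambda>(x0, x1, x2, x3) (y0, y1, y2, y3).
       (x0 \<oplus>\<^bsub>R\<^esub> y0, x1 \<oplus>\<^bsub>R\<^esub> y1, x2 \<oplus>\<^bsub>R\<^esub> y2, x3 \<oplus>\<^bsub>R\<^esub> y3))\<rparr>"

definition hamilton_ring :: "('a, 'm) ring_scheme \<Rightarrow> 'a quat ring" where
  "hamilton_ring R = quaternion_ring R (\<ominus>\<^bsub>R\<^esub> \<one>\<^bsub>R\<^esub>) (\<ominus>\<^bsub>R\<^esub> \<one>\<^bsub>R\<^esub>)"

definition split_quaternion_ring :: "('a, 'm) ring_scheme \<Rightarrow> 'a quat ring" where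
  "split_quaternion_ring R = quaternion_ring R \<one>\<^bsub>R\<^esub> \<one>\<^bsub>R\<^esub>"

text \<open>
  Square matrices of size \<open>m\<close> are functions on index pairs, \<open>undefined\<close> outside
  \<open>{..<m} \<times> {..<m}\<close>, so that a matrix is determined by its entries.
\<close>

definition matrix_ring :: "('a, 'm) ring_scheme \<Rightarrow> nat \<Rightarrow> (nat \<times> nat \<Rightarrow> 'a) ring" where
  "matrix_ring R m =
    \<lparr>carrier = ({..<m} \<times> {..<m}) \<rightarrow>\<^sub>E carrier R,
     monoid.mult = (\<lambda>A B. \<lambda>(i, j)\<in>{..<m} \<times> {..<m}. \<Oplus>\<^bsub>R\<^esub>l\<in>{..<m}. A (i, l) \<otimes>\<^bsub>R\<^esub> B (l, j)),
     one = (\<lambda>(i, j)\<in>{..<m} \<times> {..<m}. if i = j then \<one>\<^bsub>R\<^esub> else \<zero>\<^bsub>R\<^esub>),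
     zero = (\<lambda>(i, j)\<in>{..<m} \<times> {..<m}. \<zero>\<^bsub>R\<^esub>),
     add = (\<lambda>A B. \<lambda>(i, j)\<in>{..<m} \<times> {..<m}. A (i, j) \<oplus>\<^bsub>R\<^esub> B (i, j))\<rparr>"

lemma (in cring) quaternion_ring_is_ring:
  assumes [simp]: "a \<in> carrier R" "b \<in> carrier R"
  shows "ring (quaternion_ring R a b)"
proof (intro ringI abelian_groupI monoidI)
  fix x assume "x \<in> carrier (quaternion_ring R a b)"
  then obtain x0 x1 x2 x3 where "x = (x0, x1, x2, x3)"
    "x0 \<in> carrier R" "x1 \<in> carrier R" "x2 \<in> carrier R" "x3 \<in> carrier R"
    by (auto simp: quaternion_ring_def)
  then show "\<exists>y\<in>carrier (quaternion_ring R a b).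
      y \<oplus>\<^bsub>quaternion_ring R a b\<^esub> x = \<zero>\<^bsub>quaternion_ring R a b\<^esub>"
    by (intro bexI[of _ "(\<ominus> x0, \<ominus> x1, \<ominus> x2, \<ominus> x3)"]) (auto simp: quaternion_ring_def l_neg)
next
  fix x y z
  assume "x \<in> carrier (quaternion_ring R a b)" "y \<in> carrier (quaternion_ring R a b)"
    "z \<in> carrier (quaternion_ring R a b)"
  then obtain x0 x1 x2 x3 y0 y1 y2 y3 z0 z1 z2 z3 where
    eq: "x = (x0, x1, x2, x3)" "y = (y0, y1, y2, y3)" "z = (z0, z1, z2, z3)" and
    [simp]: "x0 \<in> carrier R" "x1 \<in> carrier R" "x2 \<in> carrier R" "x3 \<in> carrier R"
    "y0 \<in> carrier R" "y1 \<in> carrier R" "y2 \<in> carrier R" "y3 \<in> carrier R"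
    "z0 \<in> carrier R" "z1 \<in> carrier R" "z2 \<in> carrier R" "z3 \<in> carrier R"
    by (auto simp: quaternion_ring_def)
  show "x \<otimes>\<^bsub>quaternion_ring R a b\<^esub> y \<otimes>\<^bsub>quaternion_ring R a b\<^esub> z =
      x \<otimes>\<^bsub>quaternion_ring R a b\<^esub> (y \<otimes>\<^bsub>quaternion_ring R a b\<^esub> z)"
    unfolding eq quaternion_ring_def
    by (simp add: minus_eq l_distr r_distr l_minus r_minus minus_add a_ac m_ac)
  show "(x \<oplus>\<^bsub>quaternion_ring R a b\<^esub> y) \<otimes>\<^bsub>quaternion_ring R a b\<^esub> z =
      x \<otimes>\<^bsub>quaternion_ring R a b\<^esub> z \<oplus>\<^bsub>quaternion_ring R a b\<^esub> y \<otimes>\<^bsub>quaternion_ring R a b\<^esub> z"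
    unfolding eq quaternion_ring_def
    by (simp add: minus_eq l_distr r_distr l_minus r_minus minus_add a_ac m_ac)
  show "z \<otimes>\<^bsub>quaternion_ring R a b\<^esub> (x \<oplus>\<^bsub>quaternion_ring R a b\<^esub> y) =
      z \<otimes>\<^bsub>quaternion_ring R a b\<^esub> x \<oplus>\<^bsub>quaternion_ring R a b\<^esub> z \<otimes>\<^bsub>quaternion_ring R a b\<^esub> y"
    unfolding eq quaternion_ring_def
    by (simp add: minus_eq l_distr r_distr l_minus r_minus minus_add a_ac m_ac)
qed (auto simp: quaternion_ring_def minus_eq a_ac)

lemma (in cring) quaternion_ring_relations:
  fixes a b
  defines "Q \<equiv> quaternion_ring R a b"
    and "i \<equiv> (\<zero>, \<one>, \<zero>, \<zero>)" and "j \<equiv> (\<zero>, \<zero>, \<one>, \<zero>)" and "k \<equiv> (\<zero>, \<zero>, \<zero>, \<one>)"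
  assumes [simp]: "a \<in> carrier R" "b \<in> carrier R"
  shows "i \<otimes>\<^bsub>Q\<^esub> i = (a, \<zero>, \<zero>, \<zero>)"
    and "j \<otimes>\<^bsub>Q\<^esub> j = (b, \<zero>, \<zero>, \<zero>)"
    and "i \<otimes>\<^bsub>Q\<^esub> j = k"
    and "j \<otimes>\<^bsub>Q\<^esub> i = \<ominus>\<^bsub>Q\<^esub> k"
    and "\<lbrakk>r \<in> carrier R; x0 \<in> carrier R; x1 \<in> carrier R; x2 \<in> carrier R; x3 \<in> carrier R\<rbrakk> \<Longrightarrow>
      (r, \<zero>, \<zero>, \<zero>) \<otimes>\<^bsub>Q\<^esub> (x0, x1, x2, x3) = (r \<otimes> x0, r \<otimes> x1, r \<otimes> x2, r \<otimes> x3)"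
    and "\<lbrakk>r \<in> carrier R; x0 \<in> carrier R; x1 \<in> carrier R; x2 \<in> carrier R; x3 \<in> carrier R\<rbrakk> \<Longrightarrow>
      (x0, x1, x2, x3) \<otimes>\<^bsub>Q\<^esub> (r, \<zero>, \<zero>, \<zero>) = (r \<otimes> x0, r \<otimes> x1, r \<otimes> x2, r \<otimes> x3)"
proof -
  interpret Q: ring Q unfolding Q_def by (rule quaternion_ring_is_ring) simp_all
  have mem: "i \<in> carrier Q" "j \<in> carrier Q" "k \<in> carrier Q"
    by (simp_all add: Q_def i_def j_def k_def quaternion_ring_def)
  show "j \<otimes>\<^bsub>Q\<^esub> i = \<ominus>\<^bsub>Q\<^esub> k"
  proof (rule sym, rule Q.minus_equality)
    show "j \<otimes>\<^bsub>Q\<^esub> i \<oplus>\<^bsub>Q\<^esub> k = \<zero>\<^bsub>Q\<^esub>"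
      by (simp add: Q_def i_def j_def k_def quaternion_ring_def minus_eq l_neg)
  qed (use mem in auto)
qed (auto simp: Q_def i_def j_def k_def quaternion_ring_def minus_eq m_ac)

lemma (in abelian_monoid) finsum_lessThan_2:
  assumes "f 0 \<in> carrier G" "f 1 \<in> carrier G"
  shows "(\<Oplus>l\<in>{..<2::nat}. f l) = f 0 \<oplus> f 1"
proof -
  have "{..<2::nat} = {0, 1}" by auto
  with assms show ?thesis by simp
qed

lemma (in ring) matrix_ring_is_ring: "ring (matrix_ring R 2)"
proof -
  let ?M = "matrix_ring R 2" and ?I = "{..<2::nat} \<times> {..<2::nat}"
  have entry: "A (p, q) \<in> carrier R" if "A \<in> carrier ?M" "p < 2" "q < 2" for A p q
    using that by (auto simp: matrix_ring_def)
  have mult: "A \<otimes>\<^bsub>?M\<^esub> B = (\<lambda>(i, j)\<in>?I. A (i, 0) \<otimes> B (0, j) \<oplus> A (i, 1) \<otimes> B (1, j))"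
    if "A \<in> carrier ?M" "B \<in> carrier ?M" for A B
  proof -
    have "A \<otimes>\<^bsub>?M\<^esub> B = (\<lambda>(i, j)\<in>?I. \<Oplus>l\<in>{..<2}. A (i, l) \<otimes> B (l, j))"
      by (simp add: matrix_ring_def)
    also have "\<dots> = (\<lambda>(i, j)\<in>?I. A (i, 0) \<otimes> B (0, j) \<oplus> A (i, 1) \<otimes> B (1, j))"
      by (rule restrict_ext, clarify, rule finsum_lessThan_2) (use that entry in auto)
    finally show ?thesis .
  qed
  have add: "A \<oplus>\<^bsub>?M\<^esub> B = (\<lambda>(i, j)\<in>?I. A (i, j) \<oplus> B (i, j))" for A B
    by (simp add: matrix_ring_def)
  have zero: "\<zero>\<^bsub>?M\<^esub> = (\<lambda>(i, j)\<in>?I. \<zero>)"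
    and one: "\<one>\<^bsub>?M\<^esub> = (\<lambda>(i, j)\<in>?I. if i = j then \<one> else \<zero>)"
    by (simp_all add: matrix_ring_def)
  have memI: "(\<lambda>(i, j)\<in>?I. f i j) \<in> carrier ?M"
    if "\<And>p q. p < 2 \<Longrightarrow> q < 2 \<Longrightarrow> f p q \<in> carrier R" for f
    using that by (auto simp: matrix_ring_def)
  have zero_closed: "\<zero>\<^bsub>?M\<^esub> \<in> carrier ?M" and one_closed: "\<one>\<^bsub>?M\<^esub> \<in> carrier ?M"
    unfolding zero one by (rule memI, simp)+
  have add_closed: "A \<oplus>\<^bsub>?M\<^esub> B \<in> carrier ?M" if "A \<in> carrier ?M" "B \<in> carrier ?M" for A B
    unfolding add by (rule memI) (use that entry in auto)
  have mult_closed: "A \<otimes>\<^bsub>?M\<^esub> B \<in> carrier ?M" if "A \<in> carrier ?M" "B \<in> carrier ?M" for A B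
    unfolding mult[OF that] by (rule memI) (use that entry in auto)
  have eqI: "A = B" if "A \<in> carrier ?M" "B \<in> carrier ?M"
    "\<And>p q. p < 2 \<Longrightarrow> q < 2 \<Longrightarrow> A (p, q) = B (p, q)" for A B
    using that by (intro extensionalityI[of _ ?I]) (auto simp: matrix_ring_def PiE_def)
  have mult_entry: "(A \<otimes>\<^bsub>?M\<^esub> B) (p, q) = A (p, 0) \<otimes> B (0, q) \<oplus> A (p, 1) \<otimes> B (1, q)"
    if "A \<in> carrier ?M" "B \<in> carrier ?M" "p < 2" "q < 2" for A B p q
    using that by (simp add: mult)
  have add_entry: "(A \<oplus>\<^bsub>?M\<^esub> B) (p, q) = A (p, q) \<oplus> B (p, q)" if "p < 2" "q < 2" for A B p q
    using that by (simp add: add)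
  have zero_entry: "\<zero>\<^bsub>?M\<^esub> (p, q) = \<zero>"
    and one_entry: "\<one>\<^bsub>?M\<^esub> (p, q) = (if p = q then \<one> else \<zero>)" if "p < 2" "q < 2" for p q
    using that by (simp_all add: zero one)
  note closed = zero_closed one_closed add_closed mult_closed
  note entries = entry mult_entry add_entry zero_entry one_entry
  show ?thesis
  proof (intro ringI abelian_groupI monoidI)
    fix x assume x: "x \<in> carrier ?M"
    have neg: "(\<lambda>(i, j)\<in>?I. \<ominus> x (i, j)) \<in> carrier ?M"
      by (rule memI) (use x entry in auto)
    show "\<exists>y\<in>carrier ?M. y \<oplus>\<^bsub>?M\<^esub> x = \<zero>\<^bsub>?M\<^esub>"
      by (intro bexI[OF _ neg] eqI) (simp_all add: x neg closed entries l_neg)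
    show "\<one>\<^bsub>?M\<^esub> \<otimes>\<^bsub>?M\<^esub> x = x"
      by (rule eqI) (auto simp: x closed entries less_2_cases_iff)
    show "x \<otimes>\<^bsub>?M\<^esub> \<one>\<^bsub>?M\<^esub> = x"
      by (rule eqI) (auto simp: x closed entries less_2_cases_iff)
    fix y z assume yz: "y \<in> carrier ?M" "z \<in> carrier ?M"
    show "x \<otimes>\<^bsub>?M\<^esub> y \<otimes>\<^bsub>?M\<^esub> z = x \<otimes>\<^bsub>?M\<^esub> (y \<otimes>\<^bsub>?M\<^esub> z)"
      by (rule eqI) (simp_all add: x yz closed entries l_distr r_distr m_assoc a_ac)
    show "(x \<oplus>\<^bsub>?M\<^esub> y) \<otimes>\<^bsub>?M\<^esub> z = x \<otimes>\<^bsub>?M\<^esub> z \<oplus>\<^bsub>?M\<^esub> y \<otimes>\<^bsub>?M\<^esub> z"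
      by (rule eqI) (simp_all add: x yz closed entries l_distr a_ac)
    show "z \<otimes>\<^bsub>?M\<^esub> (x \<oplus>\<^bsub>?M\<^esub> y) = z \<otimes>\<^bsub>?M\<^esub> x \<oplus>\<^bsub>?M\<^esub> z \<otimes>\<^bsub>?M\<^esub> y"
      by (rule eqI) (simp_all add: x yz closed entries r_distr a_ac)
    show "x \<oplus>\<^bsub>?M\<^esub> y \<oplus>\<^bsub>?M\<^esub> z = x \<oplus>\<^bsub>?M\<^esub> (y \<oplus>\<^bsub>?M\<^esub> z)"
      by (rule eqI) (simp_all add: x yz closed entries a_assoc)
  next
    fix x y assume xy: "x \<in> carrier ?M" "y \<in> carrier ?M"
    show "x \<oplus>\<^bsub>?M\<^esub> y = y \<oplus>\<^bsub>?M\<^esub> x"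
      by (rule eqI) (simp_all add: xy closed entries a_comm)
  next
    fix x assume x: "x \<in> carrier ?M"
    show "\<zero>\<^bsub>?M\<^esub> \<oplus>\<^bsub>?M\<^esub> x = x"
      by (rule eqI) (simp_all add: x closed entries)
  qed (simp_all add: closed)
qed

end

theory Submission
  imports Defs "HOL-Number_Theory.Cong"
begin

text \<open>
  Write \<open>R\<close> for the residues modulo \<open>n\<close>, \<open>H\<close> for the Hamilton quaternions, \<open>L\<close> for the split
  quaternions and \<open>M\<close> for the two by two matrices over \<open>R\<close>.

  If \<open>4\<close> does not divide \<open>n\<close>, then \<open>-1\<close> is a sum of two squares \<open>c\<^sup>2 + d\<^sup>2\<close> in \<open>R\<close>: this
  is clear modulo \<open>2\<close>, follows from the pigeonhole principle modulo an odd prime, and extends to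
  \<open>n\<close> by Hensel lifting and the Chinese remainder theorem (\<open>dvd_sum_two_squares_plus_1\<close>). Over
  any commutative ring such a representation of \<open>-1\<close> gives \<open>H \<simeq> L\<close>, since \<open>c i + d j\<close> and
  \<open>k\<close> in \<open>L\<close> behave like the Hamiltonian \<open>i\<close> and \<open>j\<close>
  (\<open>hamilton_ring_iso_split_quaternion_ring\<close>). If \<open>n\<close> is odd, \<open>2\<close> is a unit, and the usual
  matrices squaring to \<open>1\<close> give \<open>L \<simeq> M\<close> (\<open>split_quaternion_ring_iso_matrix_ring\<close>).

  If \<open>n\<close> is even, then \<open>2\<close> is not a unit. Every quaternion ring becomes commutative modulo \<open>2\<close>,
  whereas \<open>M\<close> does not, so neither \<open>H\<close> nor \<open>L\<close> is isomorphic to \<open>M\<close>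
  (\<open>quaternion_ring_not_iso_matrix_ring\<close>). If \<open>4\<close> divides \<open>n\<close>, any two square roots of
  \<open>-1\<close> in \<open>L\<close> are congruent modulo \<open>2 L\<close> (\<open>ZFact_roots_minus_one_congruent\<close>), while \<open>i\<close> and
  \<open>j\<close> in \<open>H\<close> are not congruent modulo \<open>2 H\<close>; hence \<open>H\<close> and \<open>L\<close> are not isomorphic.
\<close>

section \<open>The quaternion ring and the ring of two by two matrices in coordinates\<close>

lemma quaternion_ring_carrier:
  "(x0, x1, x2, x3) \<in> carrier (quaternion_ring R a b) \<longleftrightarrow>
    x0 \<in> carrier R \<and> x1 \<in> carrier R \<and> x2 \<in> carrier R \<and> x3 \<in> carrier R"
  by (simp add: quaternion_ring_def)

lemma quaternion_ring_add:
  "(x0, x1, x2, x3) \<oplus>\<^bsub>quaternion_ring R a b\<^esub> (y0, y1, y2, y3) =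
    (x0 \<oplus>\<^bsub>R\<^esub> y0, x1 \<oplus>\<^bsub>R\<^esub> y1, x2 \<oplus>\<^bsub>R\<^esub> y2, x3 \<oplus>\<^bsub>R\<^esub> y3)"
  by (simp add: quaternion_ring_def)

lemma quaternion_ring_zero:
  "\<zero>\<^bsub>quaternion_ring R a b\<^esub> = (\<zero>\<^bsub>R\<^esub>, \<zero>\<^bsub>R\<^esub>, \<zero>\<^bsub>R\<^esub>, \<zero>\<^bsub>R\<^esub>)"
  by (simp add: quaternion_ring_def)

lemma quaternion_ring_one:
  "\<one>\<^bsub>quaternion_ring R a b\<^esub> = (\<one>\<^bsub>R\<^esub>, \<zero>\<^bsub>R\<^esub>, \<zero>\<^bsub>R\<^esub>, \<zero>\<^bsub>R\<^esub>)"
  by (simp add: quaternion_ring_def)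

context cring
begin

lemma hamilton_ring_is_ring: "ring (hamilton_ring R)"
  by (simp add: hamilton_ring_def quaternion_ring_is_ring)

lemma split_quaternion_ring_is_ring: "ring (split_quaternion_ring R)"
  by (simp add: split_quaternion_ring_def quaternion_ring_is_ring)

lemma quaternion_ring_mult:
  "(x0, x1, x2, x3) \<otimes>\<^bsub>quaternion_ring R a b\<^esub> (y0, y1, y2, y3) =
    (x0 \<otimes> y0 \<oplus> a \<otimes> (x1 \<otimes> y1) \<oplus> b \<otimes> (x2 \<otimes> y2) \<ominus> a \<otimes> b \<otimes> (x3 \<otimes> y3),
     x0 \<otimes> y1 \<oplus> x1 \<otimes> y0 \<oplus> b \<otimes> (x3 \<otimes> y2) \<ominus> b \<otimes> (x2 \<otimes> y3),
     x0 \<otimes> y2 \<oplus> x2 \<otimes> y0 \<oplus> a \<otimes> (x1 \<otimes> y3) \<ominus> a \<otimes> (x3 \<otimes> y1),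
     x0 \<otimes> y3 \<oplus> x3 \<otimes> y0 \<oplus> x1 \<otimes> y2 \<ominus> x2 \<otimes> y1)"
  by (simp add: quaternion_ring_def)

lemma split_quaternion_ring_mult:
  assumes [simp]: "x0 \<in> carrier R" "x1 \<in> carrier R" "x2 \<in> carrier R" "x3 \<in> carrier R"
    "y0 \<in> carrier R" "y1 \<in> carrier R" "y2 \<in> carrier R" "y3 \<in> carrier R"
  shows "(x0, x1, x2, x3) \<otimes>\<^bsub>split_quaternion_ring R\<^esub> (y0, y1, y2, y3) =
    (x0 \<otimes> y0 \<oplus> x1 \<otimes> y1 \<oplus> x2 \<otimes> y2 \<ominus> x3 \<otimes> y3,
     x0 \<otimes> y1 \<oplus> x1 \<otimes> y0 \<oplus> x3 \<otimes> y2 \<ominus> x2 \<otimes> y3,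
     x0 \<otimes> y2 \<oplus> x2 \<otimes> y0 \<oplus> x1 \<otimes> y3 \<ominus> x3 \<otimes> y1,
     x0 \<otimes> y3 \<oplus> x3 \<otimes> y0 \<oplus> x1 \<otimes> y2 \<ominus> x2 \<otimes> y1)"
  by (simp add: split_quaternion_ring_def quaternion_ring_mult)

lemma hamilton_ring_mult:
  assumes [simp]: "x0 \<in> carrier R" "x1 \<in> carrier R" "x2 \<in> carrier R" "x3 \<in> carrier R"
    "y0 \<in> carrier R" "y1 \<in> carrier R" "y2 \<in> carrier R" "y3 \<in> carrier R"
  shows "(x0, x1, x2, x3) \<otimes>\<^bsub>hamilton_ring R\<^esub> (y0, y1, y2, y3) =
    (x0 \<otimes> y0 \<ominus> x1 \<otimes> y1 \<ominus> x2 \<otimes> y2 \<ominus> x3 \<otimes> y3,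
     x0 \<otimes> y1 \<oplus> x1 \<otimes> y0 \<oplus> x2 \<otimes> y3 \<ominus> x3 \<otimes> y2,
     x0 \<otimes> y2 \<oplus> x2 \<otimes> y0 \<oplus> x3 \<otimes> y1 \<ominus> x1 \<otimes> y3,
     x0 \<otimes> y3 \<oplus> x3 \<otimes> y0 \<oplus> x1 \<otimes> y2 \<ominus> x2 \<otimes> y1)"
  by (simp add: hamilton_ring_def quaternion_ring_mult minus_eq l_minus a_ac)

end

text \<open>The matrix with first row \<open>(p, q)\<close> and second row \<open>(r, s)\<close>.\<close>

definition mat2 :: "'a \<Rightarrow> 'a \<Rightarrow> 'a \<Rightarrow> 'a \<Rightarrow> nat \<times> nat \<Rightarrow> 'a" where
  "mat2 p q r s = (\<lambda>(i, j)\<in>{..<2} \<times> {..<2}.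
    if i = 0 then if j = 0 then p else q else if j = 0 then r else s)"

lemma mat2_eq_iff: "mat2 p q r s = mat2 p' q' r' s' \<longleftrightarrow> p = p' \<and> q = q' \<and> r = r' \<and> s = s'"
proof
  assume *: "mat2 p q r s = mat2 p' q' r' s'"
  show "p = p' \<and> q = q' \<and> r = r' \<and> s = s'"
    using fun_cong[OF *, of "(0, 0)"] fun_cong[OF *, of "(0, 1)"]
      fun_cong[OF *, of "(1, 0)"] fun_cong[OF *, of "(1, 1)"]
    by (simp add: mat2_def)
qed simp

lemma mat2_carrier:
  "mat2 p q r s \<in> carrier (matrix_ring R 2) \<longleftrightarrow>
    p \<in> carrier R \<and> q \<in> carrier R \<and> r \<in> carrier R \<and> s \<in> carrier R"
proof -
  have "{..<2} = {0, 1 :: nat}"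
    by auto
  then show ?thesis
    by (auto simp: mat2_def matrix_ring_def PiE_def Pi_def)
qed

lemma matrix_ring_2_cases:
  assumes "A \<in> carrier (matrix_ring R 2)"
  obtains p q r s where "A = mat2 p q r s"
    "p \<in> carrier R" "q \<in> carrier R" "r \<in> carrier R" "s \<in> carrier R"
proof -
  have "A = mat2 (A (0, 0)) (A (0, 1)) (A (1, 0)) (A (1, 1))"
    using assms
    by (intro extensionalityI[of _ "{..<2} \<times> {..<2}"])
      (auto simp: matrix_ring_def mat2_def PiE_def less_2_cases_iff)
  with assms that show ?thesis
    by (metis mat2_carrier)
qed

lemma mat2_add:
  "mat2 p q r s \<oplus>\<^bsub>matrix_ring R 2\<^esub> mat2 p' q' r' s' =
    mat2 (p \<oplus>\<^bsub>R\<^esub> p') (q \<oplus>\<^bsub>R\<^esub> q') (r \<oplus>\<^bsub>R\<^esub> r') (s \<oplus>\<^bsub>R\<^esub> s')"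
  by (auto simp: matrix_ring_def mat2_def fun_eq_iff)

lemma mat2_one: "\<one>\<^bsub>matrix_ring R 2\<^esub> = mat2 \<one>\<^bsub>R\<^esub> \<zero>\<^bsub>R\<^esub> \<zero>\<^bsub>R\<^esub> \<one>\<^bsub>R\<^esub>"
  by (auto simp: matrix_ring_def mat2_def fun_eq_iff less_2_cases_iff)

lemma (in ring) mat2_mult:
  assumes [simp]: "p \<in> carrier R" "q \<in> carrier R" "r \<in> carrier R" "s \<in> carrier R"
    "p' \<in> carrier R" "q' \<in> carrier R" "r' \<in> carrier R" "s' \<in> carrier R"
  shows "mat2 p q r s \<otimes>\<^bsub>matrix_ring R 2\<^esub> mat2 p' q' r' s' =
    mat2 (p \<otimes> p' \<oplus> q \<otimes> r') (p \<otimes> q' \<oplus> q \<otimes> s') (r \<otimes> p' \<oplus> s \<otimes> r') (r \<otimes> q' \<oplus> s \<otimes> s')"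
    (is "?L = ?R")
proof
  fix x :: "nat \<times> nat"
  show "?L x = ?R x"
  proof (cases "x \<in> {..<2} \<times> {..<2}")
    case True
    then obtain i j where x: "x = (i, j)" "i < 2" "j < 2"
      by auto
    have "(\<Oplus>l\<in>{..<2}. mat2 p q r s (i, l) \<otimes> mat2 p' q' r' s' (l, j)) =
        mat2 p q r s (i, 0) \<otimes> mat2 p' q' r' s' (0, j) \<oplus>
        mat2 p q r s (i, 1) \<otimes> mat2 p' q' r' s' (1, j)"
      by (rule finsum_lessThan_2) (use x in \<open>auto simp: mat2_def\<close>)
    with x show ?thesis
      by (auto simp: matrix_ring_def mat2_def less_2_cases_iff)
  qed (auto simp: matrix_ring_def mat2_def)
qed


section \<open>Isomorphisms\<close>

context cring
begin

text \<open>
  If \<open>c\<^sup>2 + d\<^sup>2 = -1\<close>, then in the split quaternions \<open>c i + d j\<close> and \<open>k\<close> are anticommuting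
  elements with square \<open>-1\<close>, and their product is \<open>c j - d i\<close>. Sending the Hamiltonian
  \<open>i\<close>, \<open>j\<close>, \<open>k\<close> to these three elements is invertible because the determinant \<open>c\<^sup>2 + d\<^sup>2\<close> is a
  unit.
\<close>

lemma hamilton_ring_iso_split_quaternion_ring:
  assumes c [simp]: "c \<in> carrier R" and d [simp]: "d \<in> carrier R"
    and cd: "c \<otimes> c \<oplus> d \<otimes> d = \<ominus> \<one>"
  shows "hamilton_ring R \<simeq> split_quaternion_ring R"
proof -
  let ?H = "hamilton_ring R" and ?L = "split_quaternion_ring R"
  define f :: "'a quat \<Rightarrow> 'a quat" where
    "f = (\<lambda>(x0, x1, x2, x3). (x0, c \<otimes> x1 \<ominus> d \<otimes> x3, d \<otimes> x1 \<oplus> c \<otimes> x3, x2))"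
  define g :: "'a quat \<Rightarrow> 'a quat" where
    "g = (\<lambda>(y0, y1, y2, y3). (y0, \<ominus> (c \<otimes> y1 \<oplus> d \<otimes> y2), y3, d \<otimes> y1 \<ominus> c \<otimes> y2))"
  have carrier: "carrier ?H = carrier R \<times> carrier R \<times> carrier R \<times> carrier R"
    "carrier ?L = carrier R \<times> carrier R \<times> carrier R \<times> carrier R"
    by (simp_all add: hamilton_ring_def split_quaternion_ring_def quaternion_ring_def)
  have norm: "(c \<otimes> c \<oplus> d \<otimes> d) \<otimes> t = \<ominus> t" if "t \<in> carrier R" for t
    using that by (simp add: cd l_minus)
  have "f \<in> ring_iso ?H ?L"
  proof (rule ring_iso_memI)
    fix x y assume "x \<in> carrier ?H" "y \<in> carrier ?H"
    then obtain x0 x1 x2 x3 y0 y1 y2 y3 where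
      eq: "x = (x0, x1, x2, x3)" "y = (y0, y1, y2, y3)" and
      carr [simp]: "x0 \<in> carrier R" "x1 \<in> carrier R" "x2 \<in> carrier R" "x3 \<in> carrier R"
      "y0 \<in> carrier R" "y1 \<in> carrier R" "y2 \<in> carrier R" "y3 \<in> carrier R"
      by (auto simp: carrier)
    have "x0 \<otimes> y0 \<oplus> (c \<otimes> x1 \<ominus> d \<otimes> x3) \<otimes> (c \<otimes> y1 \<ominus> d \<otimes> y3)
          \<oplus> (d \<otimes> x1 \<oplus> c \<otimes> x3) \<otimes> (d \<otimes> y1 \<oplus> c \<otimes> y3) \<ominus> x2 \<otimes> y2 =
        x0 \<otimes> y0 \<oplus> (c \<otimes> c \<oplus> d \<otimes> d) \<otimes> (x1 \<otimes> y1) \<ominus> x2 \<otimes> y2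
          \<oplus> (c \<otimes> c \<oplus> d \<otimes> d) \<otimes> (x3 \<otimes> y3)"
      using carr c d by algebra
    also have "\<dots> = x0 \<otimes> y0 \<ominus> x1 \<otimes> y1 \<ominus> x2 \<otimes> y2 \<ominus> x3 \<otimes> y3"
      by (simp add: norm minus_eq)
    finally have 0: "x0 \<otimes> y0 \<ominus> x1 \<otimes> y1 \<ominus> x2 \<otimes> y2 \<ominus> x3 \<otimes> y3 =
        x0 \<otimes> y0 \<oplus> (c \<otimes> x1 \<ominus> d \<otimes> x3) \<otimes> (c \<otimes> y1 \<ominus> d \<otimes> y3)
          \<oplus> (d \<otimes> x1 \<oplus> c \<otimes> x3) \<otimes> (d \<otimes> y1 \<oplus> c \<otimes> y3) \<ominus> x2 \<otimes> y2" ..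
    have 1: "c \<otimes> (x0 \<otimes> y1 \<oplus> x1 \<otimes> y0 \<oplus> x2 \<otimes> y3 \<ominus> x3 \<otimes> y2)
          \<ominus> d \<otimes> (x0 \<otimes> y3 \<oplus> x3 \<otimes> y0 \<oplus> x1 \<otimes> y2 \<ominus> x2 \<otimes> y1) =
        x0 \<otimes> (c \<otimes> y1 \<ominus> d \<otimes> y3) \<oplus> (c \<otimes> x1 \<ominus> d \<otimes> x3) \<otimes> y0
          \<oplus> x2 \<otimes> (d \<otimes> y1 \<oplus> c \<otimes> y3) \<ominus> (d \<otimes> x1 \<oplus> c \<otimes> x3) \<otimes> y2"
      using carr c d by algebra
    have 2: "d \<otimes> (x0 \<otimes> y1 \<oplus> x1 \<otimes> y0 \<oplus> x2 \<otimes> y3 \<ominus> x3 \<otimes> y2)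
          \<oplus> c \<otimes> (x0 \<otimes> y3 \<oplus> x3 \<otimes> y0 \<oplus> x1 \<otimes> y2 \<ominus> x2 \<otimes> y1) =
        x0 \<otimes> (d \<otimes> y1 \<oplus> c \<otimes> y3) \<oplus> (d \<otimes> x1 \<oplus> c \<otimes> x3) \<otimes> y0
          \<oplus> (c \<otimes> x1 \<ominus> d \<otimes> x3) \<otimes> y2 \<ominus> x2 \<otimes> (c \<otimes> y1 \<ominus> d \<otimes> y3)"
      using carr c d by algebra
    have "x0 \<otimes> y2 \<oplus> x2 \<otimes> y0 \<oplus> (c \<otimes> x1 \<ominus> d \<otimes> x3) \<otimes> (d \<otimes> y1 \<oplus> c \<otimes> y3)
          \<ominus> (d \<otimes> x1 \<oplus> c \<otimes> x3) \<otimes> (c \<otimes> y1 \<ominus> d \<otimes> y3) =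
        x0 \<otimes> y2 \<oplus> x2 \<otimes> y0 \<oplus> (c \<otimes> c \<oplus> d \<otimes> d) \<otimes> (x1 \<otimes> y3)
          \<ominus> (c \<otimes> c \<oplus> d \<otimes> d) \<otimes> (x3 \<otimes> y1)"
      using carr c d by algebra
    also have "\<dots> = x0 \<otimes> y2 \<oplus> x2 \<otimes> y0 \<oplus> x3 \<otimes> y1 \<ominus> x1 \<otimes> y3"
      by (simp add: norm minus_eq a_ac)
    finally have 3: "x0 \<otimes> y2 \<oplus> x2 \<otimes> y0 \<oplus> x3 \<otimes> y1 \<ominus> x1 \<otimes> y3 =
        x0 \<otimes> y2 \<oplus> x2 \<otimes> y0 \<oplus> (c \<otimes> x1 \<ominus> d \<otimes> x3) \<otimes> (d \<otimes> y1 \<oplus> c \<otimes> y3)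
          \<ominus> (d \<otimes> x1 \<oplus> c \<otimes> x3) \<otimes> (c \<otimes> y1 \<ominus> d \<otimes> y3)" ..
    show "f (x \<otimes>\<^bsub>?H\<^esub> y) = f x \<otimes>\<^bsub>?L\<^esub> f y"
      by (simp add: eq f_def hamilton_ring_mult split_quaternion_ring_mult 0 1 2 3)
    have "c \<otimes> (x1 \<oplus> y1) \<ominus> d \<otimes> (x3 \<oplus> y3) = c \<otimes> x1 \<ominus> d \<otimes> x3 \<oplus> (c \<otimes> y1 \<ominus> d \<otimes> y3)"
      "d \<otimes> (x1 \<oplus> y1) \<oplus> c \<otimes> (x3 \<oplus> y3) = d \<otimes> x1 \<oplus> c \<otimes> x3 \<oplus> (d \<otimes> y1 \<oplus> c \<otimes> y3)"
      using carr c d by algebra+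
    then show "f (x \<oplus>\<^bsub>?H\<^esub> y) = f x \<oplus>\<^bsub>?L\<^esub> f y"
      by (simp add: eq f_def hamilton_ring_def split_quaternion_ring_def quaternion_ring_add)
  next
    show "bij_betw f (carrier ?H) (carrier ?L)"
    proof (rule bij_betw_byWitness[where f' = g])
      show "\<forall>x\<in>carrier ?H. g (f x) = x"
      proof
        fix x assume "x \<in> carrier ?H"
        then obtain x0 x1 x2 x3 where eq: "x = (x0, x1, x2, x3)" and
          carr [simp]: "x0 \<in> carrier R" "x1 \<in> carrier R" "x2 \<in> carrier R" "x3 \<in> carrier R"
          by (auto simp: carrier)
        have "\<ominus> (c \<otimes> (c \<otimes> x1 \<ominus> d \<otimes> x3) \<oplus> d \<otimes> (d \<otimes> x1 \<oplus> c \<otimes> x3)) =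
            \<ominus> ((c \<otimes> c \<oplus> d \<otimes> d) \<otimes> x1)"
          "d \<otimes> (c \<otimes> x1 \<ominus> d \<otimes> x3) \<ominus> c \<otimes> (d \<otimes> x1 \<oplus> c \<otimes> x3) =
            \<ominus> ((c \<otimes> c \<oplus> d \<otimes> d) \<otimes> x3)"
          using carr c d by algebra+
        then show "g (f x) = x"
          by (simp add: eq f_def g_def norm)
      qed
      show "\<forall>y\<in>carrier ?L. f (g y) = y"
      proof
        fix y assume "y \<in> carrier ?L"
        then obtain y0 y1 y2 y3 where eq: "y = (y0, y1, y2, y3)" and
          carr [simp]: "y0 \<in> carrier R" "y1 \<in> carrier R" "y2 \<in> carrier R" "y3 \<in> carrier R"
          by (auto simp: carrier)
        have "c \<otimes> (\<ominus> (c \<otimes> y1 \<oplus> d \<otimes> y2)) \<ominus> d \<otimes> (d \<otimes> y1 \<ominus> c \<otimes> y2) =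
            \<ominus> ((c \<otimes> c \<oplus> d \<otimes> d) \<otimes> y1)"
          "d \<otimes> (\<ominus> (c \<otimes> y1 \<oplus> d \<otimes> y2)) \<oplus> c \<otimes> (d \<otimes> y1 \<ominus> c \<otimes> y2) =
            \<ominus> ((c \<otimes> c \<oplus> d \<otimes> d) \<otimes> y2)"
          using carr c d by algebra+
        then show "f (g y) = y"
          by (simp add: eq f_def g_def norm)
      qed
    qed (auto simp: f_def g_def carrier)
  qed (auto simp: f_def carrier hamilton_ring_def split_quaternion_ring_def
      quaternion_ring_carrier quaternion_ring_one minus_eq)
  then show ?thesis
    by (auto simp: is_ring_iso_def)
qed

text \<open>
  The isomorphism sends \<open>i\<close> to the diagonal matrix with entries \<open>1\<close>, \<open>-1\<close> and \<open>j\<close> to the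
  permutation matrix exchanging the two coordinates; the element \<open>h\<close> is the inverse of \<open>2\<close>.
\<close>

lemma split_quaternion_ring_iso_matrix_ring:
  assumes h [simp]: "h \<in> carrier R" and hh: "h \<oplus> h = \<one>"
  shows "split_quaternion_ring R \<simeq> matrix_ring R 2"
proof -
  let ?L = "split_quaternion_ring R" and ?M = "matrix_ring R 2"
  define f where "f = (\<lambda>(x0, x1, x2, x3). mat2 (x0 \<oplus> x1) (x2 \<oplus> x3) (x2 \<ominus> x3) (x0 \<ominus> x1))"
  have carrier: "carrier ?L = carrier R \<times> carrier R \<times> carrier R \<times> carrier R"
    by (simp add: split_quaternion_ring_def quaternion_ring_def)
  have half: "(h \<oplus> h) \<otimes> t = t" if "t \<in> carrier R" for t
    using that by (simp add: hh)
  have half_eq: "u = h \<otimes> ((u \<oplus> v) \<oplus> (u \<ominus> v))" "v = h \<otimes> ((u \<oplus> v) \<ominus> (u \<ominus> v))"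
    "h \<otimes> (u \<oplus> v) \<oplus> h \<otimes> (u \<ominus> v) = u" "h \<otimes> (u \<oplus> v) \<ominus> h \<otimes> (u \<ominus> v) = v"
    if carr [simp]: "u \<in> carrier R" "v \<in> carrier R" for u v
  proof -
    have "h \<otimes> ((u \<oplus> v) \<oplus> (u \<ominus> v)) = (h \<oplus> h) \<otimes> u"
      "h \<otimes> ((u \<oplus> v) \<ominus> (u \<ominus> v)) = (h \<oplus> h) \<otimes> v"
      "h \<otimes> (u \<oplus> v) \<oplus> h \<otimes> (u \<ominus> v) = (h \<oplus> h) \<otimes> u"
      "h \<otimes> (u \<oplus> v) \<ominus> h \<otimes> (u \<ominus> v) = (h \<oplus> h) \<otimes> v"
      using carr h by algebra+
    then show "u = h \<otimes> ((u \<oplus> v) \<oplus> (u \<ominus> v))" "v = h \<otimes> ((u \<oplus> v) \<ominus> (u \<ominus> v))"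
      "h \<otimes> (u \<oplus> v) \<oplus> h \<otimes> (u \<ominus> v) = u" "h \<otimes> (u \<oplus> v) \<ominus> h \<otimes> (u \<ominus> v) = v"
      by (simp_all add: half)
  qed
  have "f \<in> ring_iso ?L ?M"
  proof (rule ring_iso_memI)
    fix x y assume "x \<in> carrier ?L" "y \<in> carrier ?L"
    then obtain x0 x1 x2 x3 y0 y1 y2 y3 where
      eq: "x = (x0, x1, x2, x3)" "y = (y0, y1, y2, y3)" and
      carr [simp]: "x0 \<in> carrier R" "x1 \<in> carrier R" "x2 \<in> carrier R" "x3 \<in> carrier R"
      "y0 \<in> carrier R" "y1 \<in> carrier R" "y2 \<in> carrier R" "y3 \<in> carrier R"
      by (auto simp: carrier)
    have "(x0 \<otimes> y0 \<oplus> x1 \<otimes> y1 \<oplus> x2 \<otimes> y2 \<ominus> x3 \<otimes> y3)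
          \<oplus> (x0 \<otimes> y1 \<oplus> x1 \<otimes> y0 \<oplus> x3 \<otimes> y2 \<ominus> x2 \<otimes> y3) =
        (x0 \<oplus> x1) \<otimes> (y0 \<oplus> y1) \<oplus> (x2 \<oplus> x3) \<otimes> (y2 \<ominus> y3)"
      "(x0 \<otimes> y2 \<oplus> x2 \<otimes> y0 \<oplus> x1 \<otimes> y3 \<ominus> x3 \<otimes> y1)
          \<oplus> (x0 \<otimes> y3 \<oplus> x3 \<otimes> y0 \<oplus> x1 \<otimes> y2 \<ominus> x2 \<otimes> y1) =
        (x0 \<oplus> x1) \<otimes> (y2 \<oplus> y3) \<oplus> (x2 \<oplus> x3) \<otimes> (y0 \<ominus> y1)"
      "(x0 \<otimes> y2 \<oplus> x2 \<otimes> y0 \<oplus> x1 \<otimes> y3 \<ominus> x3 \<otimes> y1)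
          \<ominus> (x0 \<otimes> y3 \<oplus> x3 \<otimes> y0 \<oplus> x1 \<otimes> y2 \<ominus> x2 \<otimes> y1) =
        (x2 \<ominus> x3) \<otimes> (y0 \<oplus> y1) \<oplus> (x0 \<ominus> x1) \<otimes> (y2 \<ominus> y3)"
      "(x0 \<otimes> y0 \<oplus> x1 \<otimes> y1 \<oplus> x2 \<otimes> y2 \<ominus> x3 \<otimes> y3)
          \<ominus> (x0 \<otimes> y1 \<oplus> x1 \<otimes> y0 \<oplus> x3 \<otimes> y2 \<ominus> x2 \<otimes> y3) =
        (x2 \<ominus> x3) \<otimes> (y2 \<oplus> y3) \<oplus> (x0 \<ominus> x1) \<otimes> (y0 \<ominus> y1)"
      using carr by algebra+
    then show "f (x \<otimes>\<^bsub>?L\<^esub> y) = f x \<otimes>\<^bsub>?M\<^esub> f y"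
      by (simp add: eq f_def split_quaternion_ring_mult mat2_mult)
    have "x0 \<oplus> y0 \<oplus> (x1 \<oplus> y1) = x0 \<oplus> x1 \<oplus> (y0 \<oplus> y1)"
      "x2 \<oplus> y2 \<oplus> (x3 \<oplus> y3) = x2 \<oplus> x3 \<oplus> (y2 \<oplus> y3)"
      "x2 \<oplus> y2 \<ominus> (x3 \<oplus> y3) = x2 \<ominus> x3 \<oplus> (y2 \<ominus> y3)"
      "x0 \<oplus> y0 \<ominus> (x1 \<oplus> y1) = x0 \<ominus> x1 \<oplus> (y0 \<ominus> y1)"
      using carr by algebra+
    then show "f (x \<oplus>\<^bsub>?L\<^esub> y) = f x \<oplus>\<^bsub>?M\<^esub> f y"
      by (simp add: eq f_def split_quaternion_ring_def quaternion_ring_add mat2_add)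
  next
    have "inj_on f (carrier ?L)"
    proof (rule inj_onI)
      fix x y assume "x \<in> carrier ?L" "y \<in> carrier ?L" and fxy: "f x = f y"
      then obtain x0 x1 x2 x3 y0 y1 y2 y3 where
        eq: "x = (x0, x1, x2, x3)" "y = (y0, y1, y2, y3)" and
        carr [simp]: "x0 \<in> carrier R" "x1 \<in> carrier R" "x2 \<in> carrier R" "x3 \<in> carrier R"
        "y0 \<in> carrier R" "y1 \<in> carrier R" "y2 \<in> carrier R" "y3 \<in> carrier R"
        by (auto simp: carrier)
      have "x0 \<oplus> x1 = y0 \<oplus> y1" "x0 \<ominus> x1 = y0 \<ominus> y1" "x2 \<oplus> x3 = y2 \<oplus> y3" "x2 \<ominus> x3 = y2 \<ominus> y3"
        using fxy by (simp_all add: eq f_def mat2_eq_iff)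
      then show "x = y"
        using half_eq(1,2)[of x0 x1] half_eq(1,2)[of y0 y1]
          half_eq(1,2)[of x2 x3] half_eq(1,2)[of y2 y3]
        by (simp add: eq)
    qed
    moreover have "f ` carrier ?L = carrier ?M"
    proof
      show "carrier ?M \<subseteq> f ` carrier ?L"
      proof
        fix A assume "A \<in> carrier ?M"
        then obtain p q r s where A: "A = mat2 p q r s" and
          [simp]: "p \<in> carrier R" "q \<in> carrier R" "r \<in> carrier R" "s \<in> carrier R"
          by (rule matrix_ring_2_cases)
        show "A \<in> f ` carrier ?L"
          by (rule image_eqI[of _ _ "(h \<otimes> (p \<oplus> s), h \<otimes> (p \<ominus> s), h \<otimes> (q \<oplus> r), h \<otimes> (q \<ominus> r))"])
            (simp_all add: A f_def half_eq carrier)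
      qed
    qed (auto simp: f_def carrier mat2_carrier)
    ultimately show "bij_betw f (carrier ?L) (carrier ?M)"
      by (simp add: bij_betw_def)
  qed (auto simp: f_def mat2_carrier split_quaternion_ring_def quaternion_ring_carrier
      quaternion_ring_one mat2_one minus_eq)
  then show ?thesis
    by (auto simp: is_ring_iso_def)
qed

end


section \<open>Obstructions to isomorphism\<close>

context cring
begin

text \<open>Modulo \<open>2\<close> a quaternion ring is commutative, because there \<open>j i = - i j = i j\<close>.\<close>

lemma quaternion_ring_commute_mod_2:
  assumes "a \<in> carrier R" "b \<in> carrier R"
    and "x \<in> carrier (quaternion_ring R a b)" "y \<in> carrier (quaternion_ring R a b)"
  obtains z where "z \<in> carrier (quaternion_ring R a b)"
    "x \<otimes>\<^bsub>quaternion_ring R a b\<^esub> y =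
      y \<otimes>\<^bsub>quaternion_ring R a b\<^esub> x \<oplus>\<^bsub>quaternion_ring R a b\<^esub> (z \<oplus>\<^bsub>quaternion_ring R a b\<^esub> z)"
proof -
  note [simp] = assms(1,2)
  obtain x0 x1 x2 x3 y0 y1 y2 y3 where
    eq: "x = (x0, x1, x2, x3)" "y = (y0, y1, y2, y3)" and
    carr [simp]: "x0 \<in> carrier R" "x1 \<in> carrier R" "x2 \<in> carrier R" "x3 \<in> carrier R"
    "y0 \<in> carrier R" "y1 \<in> carrier R" "y2 \<in> carrier R" "y3 \<in> carrier R"
    using assms(3,4) by (auto simp: quaternion_ring_def)
  let ?z1 = "b \<otimes> (x3 \<otimes> y2) \<ominus> b \<otimes> (x2 \<otimes> y3)"
    and ?z2 = "a \<otimes> (x1 \<otimes> y3) \<ominus> a \<otimes> (x3 \<otimes> y1)"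
    and ?z3 = "x1 \<otimes> y2 \<ominus> x2 \<otimes> y1"
  have "x0 \<otimes> y0 \<oplus> a \<otimes> (x1 \<otimes> y1) \<oplus> b \<otimes> (x2 \<otimes> y2) \<ominus> a \<otimes> b \<otimes> (x3 \<otimes> y3) =
      y0 \<otimes> x0 \<oplus> a \<otimes> (y1 \<otimes> x1) \<oplus> b \<otimes> (y2 \<otimes> x2) \<ominus> a \<otimes> b \<otimes> (y3 \<otimes> x3)"
    "x0 \<otimes> y1 \<oplus> x1 \<otimes> y0 \<oplus> b \<otimes> (x3 \<otimes> y2) \<ominus> b \<otimes> (x2 \<otimes> y3) =
      y0 \<otimes> x1 \<oplus> y1 \<otimes> x0 \<oplus> b \<otimes> (y3 \<otimes> x2) \<ominus> b \<otimes> (y2 \<otimes> x3) \<oplus> (?z1 \<oplus> ?z1)"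
    "x0 \<otimes> y2 \<oplus> x2 \<otimes> y0 \<oplus> a \<otimes> (x1 \<otimes> y3) \<ominus> a \<otimes> (x3 \<otimes> y1) =
      y0 \<otimes> x2 \<oplus> y2 \<otimes> x0 \<oplus> a \<otimes> (y1 \<otimes> x3) \<ominus> a \<otimes> (y3 \<otimes> x1) \<oplus> (?z2 \<oplus> ?z2)"
    "x0 \<otimes> y3 \<oplus> x3 \<otimes> y0 \<oplus> x1 \<otimes> y2 \<ominus> x2 \<otimes> y1 =
      y0 \<otimes> x3 \<oplus> y3 \<otimes> x0 \<oplus> y1 \<otimes> x2 \<ominus> y2 \<otimes> x1 \<oplus> (?z3 \<oplus> ?z3)"
    using carr assms(1,2) by algebra+
  then have "x \<otimes>\<^bsub>quaternion_ring R a b\<^esub> y = y \<otimes>\<^bsub>quaternion_ring R a b\<^esub> x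
      \<oplus>\<^bsub>quaternion_ring R a b\<^esub> ((\<zero>, ?z1, ?z2, ?z3) \<oplus>\<^bsub>quaternion_ring R a b\<^esub> (\<zero>, ?z1, ?z2, ?z3))"
    by (simp add: eq quaternion_ring_mult quaternion_ring_add)
  then show ?thesis
    by (intro that[of "(\<zero>, ?z1, ?z2, ?z3)"]) (simp_all add: quaternion_ring_carrier)
qed

lemma quaternion_ring_not_iso_matrix_ring:
  assumes [simp]: "a \<in> carrier R" "b \<in> carrier R"
    and two: "\<And>h. h \<in> carrier R \<Longrightarrow> h \<oplus> h \<noteq> \<one>"
  shows "\<not> quaternion_ring R a b \<simeq> matrix_ring R 2"
proof
  let ?Q = "quaternion_ring R a b" and ?M = "matrix_ring R 2"
  assume "?Q \<simeq> ?M"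
  then obtain f where f: "f \<in> ring_iso ?Q ?M"
    by (auto simp: is_ring_iso_def)
  interpret Q: ring ?Q
    by (rule quaternion_ring_is_ring) simp_all
  have surj: "f ` carrier ?Q = carrier ?M"
    using ring_iso_memE(5)[OF f] by (simp add: bij_betw_def)
  \<comment> \<open>The matrix units \<open>e\<^sub>1\<^sub>1\<close> and \<open>e\<^sub>1\<^sub>2\<close> have commutator \<open>e\<^sub>1\<^sub>2\<close>.\<close>
  let ?A = "mat2 \<one> \<zero> \<zero> \<zero>" and ?B = "mat2 \<zero> \<one> \<zero> \<zero>"
  have "?A \<in> f ` carrier ?Q" "?B \<in> f ` carrier ?Q"
    by (simp_all add: surj mat2_carrier)
  then obtain x y where xy: "x \<in> carrier ?Q" "y \<in> carrier ?Q" "f x = ?A" "f y = ?B"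
    by auto
  obtain z where z: "z \<in> carrier ?Q"
    "x \<otimes>\<^bsub>?Q\<^esub> y = y \<otimes>\<^bsub>?Q\<^esub> x \<oplus>\<^bsub>?Q\<^esub> (z \<oplus>\<^bsub>?Q\<^esub> z)"
    using xy by (auto intro: quaternion_ring_commute_mod_2[of a b x y])
  have "f z \<in> carrier ?M"
    using ring_iso_memE(1)[OF f] z by simp
  then obtain p q r s where C: "f z = mat2 p q r s" and
    [simp]: "p \<in> carrier R" "q \<in> carrier R" "r \<in> carrier R" "s \<in> carrier R"
    by (rule matrix_ring_2_cases)
  have "f (x \<otimes>\<^bsub>?Q\<^esub> y) = f (y \<otimes>\<^bsub>?Q\<^esub> x \<oplus>\<^bsub>?Q\<^esub> (z \<oplus>\<^bsub>?Q\<^esub> z))"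
    using z by simp
  then have "?A \<otimes>\<^bsub>?M\<^esub> ?B = ?B \<otimes>\<^bsub>?M\<^esub> ?A \<oplus>\<^bsub>?M\<^esub> (f z \<oplus>\<^bsub>?M\<^esub> f z)"
    using xy z(1) by (simp add: ring_iso_memE(2,3)[OF f])
  then have "q \<oplus> q = \<one>"
    by (simp add: C mat2_mult mat2_add mat2_eq_iff)
  with two[of q] show False
    by simp
qed

text \<open>
  If \<open>2\<close> is not a unit, the Hamiltonian \<open>i\<close> and \<open>j\<close> are square roots of \<open>-1\<close> that are
  incongruent modulo \<open>2\<close>, so an isomorphism is impossible as soon as all square roots of \<open>-1\<close>
  among the split quaternions are congruent modulo \<open>2\<close>.
\<close>

lemma hamilton_ring_not_iso_split_quaternion_ring:
  assumes two: "\<And>h. h \<in> carrier R \<Longrightarrow> h \<oplus> h \<noteq> \<one>"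
    and roots: "\<And>x y. \<lbrakk>x \<in> carrier (split_quaternion_ring R); y \<in> carrier (split_quaternion_ring R);
      x \<otimes>\<^bsub>split_quaternion_ring R\<^esub> x \<oplus>\<^bsub>split_quaternion_ring R\<^esub> \<one>\<^bsub>split_quaternion_ring R\<^esub>
        = \<zero>\<^bsub>split_quaternion_ring R\<^esub>;
      y \<otimes>\<^bsub>split_quaternion_ring R\<^esub> y \<oplus>\<^bsub>split_quaternion_ring R\<^esub> \<one>\<^bsub>split_quaternion_ring R\<^esub>
        = \<zero>\<^bsub>split_quaternion_ring R\<^esub>\<rbrakk> \<Longrightarrow>
      \<exists>z\<in>carrier (split_quaternion_ring R).
        x = y \<oplus>\<^bsub>split_quaternion_ring R\<^esub> (z \<oplus>\<^bsub>split_quaternion_ring R\<^esub> z)"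
  shows "\<not> hamilton_ring R \<simeq> split_quaternion_ring R"
proof
  let ?H = "hamilton_ring R" and ?L = "split_quaternion_ring R"
  assume "?H \<simeq> ?L"
  then obtain f where f: "f \<in> ring_iso ?H ?L"
    by (auto simp: is_ring_iso_def)
  interpret H: ring ?H
    by (rule hamilton_ring_is_ring)
  interpret L: ring ?L
    by (rule split_quaternion_ring_is_ring)
  have f_zero: "f \<zero>\<^bsub>?H\<^esub> = \<zero>\<^bsub>?L\<^esub>"
    using f H.ring_axioms L.ring_axioms by (intro ring_hom_zero) (auto simp: ring_iso_def)
  have root: "f x \<otimes>\<^bsub>?L\<^esub> f x \<oplus>\<^bsub>?L\<^esub> \<one>\<^bsub>?L\<^esub> = \<zero>\<^bsub>?L\<^esub>"
    if "x \<in> carrier ?H" "x \<otimes>\<^bsub>?H\<^esub> x \<oplus>\<^bsub>?H\<^esub> \<one>\<^bsub>?H\<^esub> = \<zero>\<^bsub>?H\<^esub>" for x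
  proof -
    have "f x \<otimes>\<^bsub>?L\<^esub> f x \<oplus>\<^bsub>?L\<^esub> \<one>\<^bsub>?L\<^esub> = f (x \<otimes>\<^bsub>?H\<^esub> x \<oplus>\<^bsub>?H\<^esub> \<one>\<^bsub>?H\<^esub>)"
      using that(1) by (simp add: ring_iso_memE(2-4)[OF f])
    then show ?thesis
      using that(2) f_zero by simp
  qed
  let ?i = "(\<zero>, \<one>, \<zero>, \<zero>)" and ?j = "(\<zero>, \<zero>, \<one>, \<zero>)"
  have ij: "?i \<in> carrier ?H" "?j \<in> carrier ?H"
    by (simp_all add: hamilton_ring_def quaternion_ring_carrier)
  have "?i \<otimes>\<^bsub>?H\<^esub> ?i \<oplus>\<^bsub>?H\<^esub> \<one>\<^bsub>?H\<^esub> = \<zero>\<^bsub>?H\<^esub>" "?j \<otimes>\<^bsub>?H\<^esub> ?j \<oplus>\<^bsub>?H\<^esub> \<one>\<^bsub>?H\<^esub> = \<zero>\<^bsub>?H\<^esub>"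
    by (simp_all add: hamilton_ring_mult,
        simp_all add: hamilton_ring_def quaternion_ring_add quaternion_ring_one
          quaternion_ring_zero minus_eq l_neg)
  then obtain w where w: "w \<in> carrier ?L" "f ?i = f ?j \<oplus>\<^bsub>?L\<^esub> (w \<oplus>\<^bsub>?L\<^esub> w)"
    using roots[of "f ?i" "f ?j"] root ij ring_iso_memE(1)[OF f] by blast
  have bij: "bij_betw f (carrier ?H) (carrier ?L)"
    using ring_iso_memE(5)[OF f] .
  obtain z where z: "z \<in> carrier ?H" "w = f z"
    using w(1) bij unfolding bij_betw_def by blast
  have "f ?i = f (?j \<oplus>\<^bsub>?H\<^esub> (z \<oplus>\<^bsub>?H\<^esub> z))"
    using w(2) z ij by (simp add: ring_iso_memE(3)[OF f])
  then have "?i = ?j \<oplus>\<^bsub>?H\<^esub> (z \<oplus>\<^bsub>?H\<^esub> z)"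
    using inj_onD[OF bij_betw_imp_inj_on[OF bij]] z(1) ij by simp
  moreover obtain z0 z1 z2 z3 where "z = (z0, z1, z2, z3)" "z1 \<in> carrier R"
    using z(1) by (auto simp: hamilton_ring_def quaternion_ring_def)
  ultimately have "z1 \<oplus> z1 = \<one>"
    by (simp add: hamilton_ring_def quaternion_ring_add)
  with two[of z1] \<open>z1 \<in> carrier R\<close> show False
    by simp
qed

end


section \<open>Residues modulo an integer\<close>

lemma ZFact_carrier: "carrier (ZFact k) = range (ZMod k)"
  by (auto simp: ZFact_defs A_RCOSETS_def' ZMod_def)

lemma ZMod_ring_hom: "ZMod k \<in> ring_hom \<Z> (ZFact k)"
proof -
  have "ZMod k = (+>\<^bsub>\<Z>\<^esub>) (Idl\<^bsub>\<Z>\<^esub> {k})"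
    by (simp add: fun_eq_iff ZMod_def)
  then show ?thesis
    by (simp add: ZFact_def ideal.rcos_ring_hom int.genideal_ideal)
qed

lemma ZMod_carrier [simp]: "ZMod k a \<in> carrier (ZFact k)"
  by (simp add: ZFact_carrier)

lemma ZFact_mult: "ZMod k a \<otimes>\<^bsub>ZFact k\<^esub> ZMod k b = ZMod k (a * b)"
  using ring_hom_mult[OF ZMod_ring_hom, of a b] by simp

lemma ZFact_add: "ZMod k a \<oplus>\<^bsub>ZFact k\<^esub> ZMod k b = ZMod k (a + b)"
  using ring_hom_add[OF ZMod_ring_hom, of a b] by simp

lemma ZFact_one_eq: "\<one>\<^bsub>ZFact k\<^esub> = ZMod k 1"
  using ring_hom_one[OF ZMod_ring_hom, of k] by simp

lemma ZFact_zero_eq: "\<zero>\<^bsub>ZFact k\<^esub> = ZMod k 0"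
  using ring_hom_zero[OF ZMod_ring_hom, of k] int.ring_axioms cring.axioms(1)[OF ZFact_is_cring]
  by simp

lemma ZFact_uminus: "\<ominus>\<^bsub>ZFact k\<^esub> ZMod k a = ZMod k (- a)"
proof -
  interpret cring "ZFact k"
    by (rule ZFact_is_cring)
  show ?thesis
    by (rule minus_equality) (simp_all add: ZFact_add ZFact_zero_eq)
qed

lemma ZFact_minus: "ZMod k a \<ominus>\<^bsub>ZFact k\<^esub> ZMod k b = ZMod k (a - b)"
  by (simp add: a_minus_def ZFact_uminus ZFact_add)

lemma ZMod_eq_iff: "ZMod k a = ZMod k b \<longleftrightarrow> k dvd a - b"
  by (simp add: ZMod_eq_mod mod_eq_dvd_iff)

lemmas ZFact_arith = ZFact_mult ZFact_add ZFact_one_eq ZFact_zero_eq ZFact_uminus ZFact_minus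
  ZMod_eq_iff

lemma ZFact_half:
  assumes "odd k"
  obtains h where "h \<in> carrier (ZFact k)" "h \<oplus>\<^bsub>ZFact k\<^esub> h = \<one>\<^bsub>ZFact k\<^esub>"
proof -
  obtain m where "k = 2 * m + 1"
    using assms by (rule oddE)
  then have "m + 1 + (m + 1) - 1 = k"
    by simp
  then show ?thesis
    by (intro that[of "ZMod k (m + 1)"]) (simp_all add: ZFact_arith del: add_diff_cancel_left')
qed

lemma ZFact_no_half:
  assumes "even k" "h \<in> carrier (ZFact k)"
  shows "h \<oplus>\<^bsub>ZFact k\<^esub> h \<noteq> \<one>\<^bsub>ZFact k\<^esub>"
proof
  obtain a where "h = ZMod k a"
    using assms(2) by (auto simp: ZFact_carrier)
  moreover assume "h \<oplus>\<^bsub>ZFact k\<^esub> h = \<one>\<^bsub>ZFact k\<^esub>"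
  ultimately have "k dvd a + a - 1"
    by (simp only: ZFact_arith)
  with assms(1) have "2 dvd a + a - 1"
    by (rule dvd_trans)
  then show False
    by presburger
qed

lemma int_square_mod_4: "(x::int) * x mod 4 = (if even x then 0 else 1)"
proof (cases "even x")
  case True
  then obtain y where "x = 2 * y" ..
  then have "x * x = 4 * (y * y)"
    by simp
  then show ?thesis
    using True by simp
next
  case False
  then obtain y where "x = 2 * y + 1"
    by (rule oddE)
  then have "x * x = 4 * (y * y + y) + 1"
    by (simp add: algebra_simps)
  then have "x * x mod 4 = 1"
    by presburger
  then show ?thesis
    using False by simp
qed

lemma root_minus_one_parity:
  fixes x0 x1 x2 x3 :: int
  assumes 0: "4 dvd x0 * x0 + x1 * x1 + x2 * x2 - x3 * x3 + 1"
    and 1: "4 dvd 2 * (x0 * x1)" and 2: "4 dvd 2 * (x0 * x2)" and 3: "4 dvd 2 * (x0 * x3)"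
  shows "even x0 \<and> even x1 \<and> even x2 \<and> odd x3"
proof -
  have prods: "even (x0 * x1)" "even (x0 * x2)" "even (x0 * x3)"
    using 1 2 3 dvd_times_left_cancel_iff[of "2 :: int" 2] by simp_all
  have "(x0 * x0 mod 4 + x1 * x1 mod 4 + x2 * x2 mod 4 - x3 * x3 mod 4 + 1) mod 4 = 0"
    using 0 by presburger
  with prods show ?thesis
    by (auto simp: int_square_mod_4 split: if_splits)
qed

text \<open>
  A split quaternion \<open>x\<close> with integer coordinates whose square is congruent to \<open>-1\<close> modulo \<open>4\<close>
  is congruent to the quaternion unit \<open>k\<close> modulo \<open>2\<close>. Indeed the real part of \<open>x\<^sup>2\<close> is \<open>x0\<^sup>2 + x1\<^sup>2 + x2\<^sup>2 - x3\<^sup>2\<close> and the imaginary parts are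
  \<open>2 x0 xl\<close>. If \<open>x0\<close> were odd, the other coordinates would be even and the real part would be \<open>1\<close>;
  and \<open>x1\<^sup>2 + x2\<^sup>2 - x3\<^sup>2 \<equiv> -1\<close> modulo \<open>4\<close> forces \<open>x1\<close>, \<open>x2\<close> even and \<open>x3\<close> odd.
\<close>

lemma ZFact_root_minus_one_parity:
  assumes "4 dvd k" and x: "x \<in> carrier (split_quaternion_ring (ZFact k))"
    and root: "x \<otimes>\<^bsub>split_quaternion_ring (ZFact k)\<^esub> x \<oplus>\<^bsub>split_quaternion_ring (ZFact k)\<^esub>
      \<one>\<^bsub>split_quaternion_ring (ZFact k)\<^esub> = \<zero>\<^bsub>split_quaternion_ring (ZFact k)\<^esub>"
  obtains x0 x1 x2 x3 where "x = (ZMod k x0, ZMod k x1, ZMod k x2, ZMod k x3)"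
    "even x0" "even x1" "even x2" "odd x3"
proof -
  interpret cring "ZFact k"
    by (rule ZFact_is_cring)
  obtain x0 x1 x2 x3 where eq: "x = (ZMod k x0, ZMod k x1, ZMod k x2, ZMod k x3)"
    using x by (auto simp: split_quaternion_ring_def quaternion_ring_def ZFact_carrier)
  let ?x = "(ZMod k x0, ZMod k x1, ZMod k x2, ZMod k x3)"
  have "?x \<otimes>\<^bsub>split_quaternion_ring (ZFact k)\<^esub> ?x =
      (ZMod k (x0 * x0 + x1 * x1 + x2 * x2 - x3 * x3), ZMod k (2 * (x0 * x1)),
       ZMod k (2 * (x0 * x2)), ZMod k (2 * (x0 * x3)))"
    by (simp add: split_quaternion_ring_mult, simp add: ZFact_arith algebra_simps)
  then have "k dvd x0 * x0 + x1 * x1 + x2 * x2 - x3 * x3 + 1"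
    "k dvd 2 * (x0 * x1)" "k dvd 2 * (x0 * x2)" "k dvd 2 * (x0 * x3)"
    using root unfolding eq
    by (simp_all add: split_quaternion_ring_def quaternion_ring_add quaternion_ring_one
        quaternion_ring_zero ZFact_arith)
  then have "even x0 \<and> even x1 \<and> even x2 \<and> odd x3"
    using \<open>4 dvd k\<close> by (intro root_minus_one_parity) (auto intro: dvd_trans)
  with eq that show ?thesis
    by blast
qed

lemma ZFact_roots_minus_one_congruent:
  assumes k: "4 dvd k"
    and x: "x \<in> carrier (split_quaternion_ring (ZFact k))"
      "x \<otimes>\<^bsub>split_quaternion_ring (ZFact k)\<^esub> x \<oplus>\<^bsub>split_quaternion_ring (ZFact k)\<^esub>
        \<one>\<^bsub>split_quaternion_ring (ZFact k)\<^esub> = \<zero>\<^bsub>split_quaternion_ring (ZFact k)\<^esub>"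
    and y: "y \<in> carrier (split_quaternion_ring (ZFact k))"
      "y \<otimes>\<^bsub>split_quaternion_ring (ZFact k)\<^esub> y \<oplus>\<^bsub>split_quaternion_ring (ZFact k)\<^esub>
        \<one>\<^bsub>split_quaternion_ring (ZFact k)\<^esub> = \<zero>\<^bsub>split_quaternion_ring (ZFact k)\<^esub>"
  shows "\<exists>z\<in>carrier (split_quaternion_ring (ZFact k)).
    x = y \<oplus>\<^bsub>split_quaternion_ring (ZFact k)\<^esub> (z \<oplus>\<^bsub>split_quaternion_ring (ZFact k)\<^esub> z)"
proof -
  obtain x0 x1 x2 x3 where X: "x = (ZMod k x0, ZMod k x1, ZMod k x2, ZMod k x3)"
    "even x0" "even x1" "even x2" "odd x3"
    using ZFact_root_minus_one_parity[OF k x] .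
  obtain y0 y1 y2 y3 where Y: "y = (ZMod k y0, ZMod k y1, ZMod k y2, ZMod k y3)"
    "even y0" "even y1" "even y2" "odd y3"
    using ZFact_root_minus_one_parity[OF k y] .
  have "even (x0 - y0)" "even (x1 - y1)" "even (x2 - y2)" "even (x3 - y3)"
    using X Y by simp_all
  then obtain z0 z1 z2 z3 where
    "x0 - y0 = 2 * z0" "x1 - y1 = 2 * z1" "x2 - y2 = 2 * z2" "x3 - y3 = 2 * z3"
    unfolding dvd_def by blast
  then have "x0 = y0 + (z0 + z0)" "x1 = y1 + (z1 + z1)" "x2 = y2 + (z2 + z2)" "x3 = y3 + (z3 + z3)"
    by simp_all
  then show ?thesis
    by (intro bexI[of _ "(ZMod k z0, ZMod k z1, ZMod k z2, ZMod k z3)"])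
      (simp_all add: X(1) Y(1) split_quaternion_ring_def quaternion_ring_carrier
        quaternion_ring_add ZFact_add)
qed


section \<open>Minus one as a sum of two squares modulo an integer\<close>

text \<open>
  Modulo \<open>p = 2 q + 1\<close> the \<open>q + 1\<close> numbers \<open>c\<^sup>2\<close> and the \<open>q + 1\<close> numbers \<open>-1 - d\<^sup>2\<close>, for
  \<open>0 \<le> c, d \<le> q\<close>, take more than \<open>p\<close> values in total, so the two families meet.
\<close>

lemma odd_prime_dvd_sum_two_squares_plus_1:
  fixes p :: int
  assumes p: "prime p" "odd p"
  shows "\<exists>c d. p dvd c * c + d * d + 1"
proof -
  obtain q where q: "p = 2 * q + 1"
    using p(2) by (rule oddE)
  have p0: "p > 1"
    using p(1) by (rule prime_gt_1_int)
  have sq_inj: "c = d" if "c \<in> {0..q}" "d \<in> {0..q}" "p dvd c * c - d * d" for c d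
  proof -
    have "p dvd (c - d) * (c + d)"
      using that(3) by (simp add: algebra_simps)
    then consider "p dvd c - d" | "p dvd c + d"
      using prime_dvd_multD[OF p(1)] by blast
    then show ?thesis
    proof cases
      case 1
      then show ?thesis
        using that(1,2) q zdvd_imp_le[of p "c - d"] zdvd_imp_le[of p "d - c"]
        by (cases c d rule: linorder_cases) (auto simp: dvd_diff_commute)
    next
      case 2
      then show ?thesis
        using that(1,2) q zdvd_imp_le[of p "c + d"] by fastforce
    qed
  qed
  let ?A = "(\<lambda>c. c * c mod p) ` {0..q}" and ?B = "(\<lambda>d. (- 1 - d * d) mod p) ` {0..q}"
  have "inj_on (\<lambda>c. c * c mod p) {0..q}"
    by (auto intro!: inj_onI sq_inj simp: mod_eq_dvd_iff)
  then have A: "card ?A = nat (q + 1)"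
    by (simp add: card_image)
  have "inj_on (\<lambda>d. (- 1 - d * d) mod p) {0..q}"
    by (auto intro!: inj_onI sq_inj simp: mod_eq_dvd_iff dvd_diff_commute)
  then have B: "card ?B = nat (q + 1)"
    by (simp add: card_image)
  have "?A \<inter> ?B \<noteq> {}"
  proof
    assume "?A \<inter> ?B = {}"
    then have "card (?A \<union> ?B) = nat (q + 1) + nat (q + 1)"
      using A B by (simp add: card_Un_disjoint)
    moreover have "card (?A \<union> ?B) \<le> card {0..<p}"
      by (rule card_mono) (use p0 in auto)
    ultimately show False
      using q p0 by simp
  qed
  then obtain c d where "c * c mod p = (- 1 - d * d) mod p"
    by auto
  then have "p dvd c * c - (- 1 - d * d)"
    by (simp add: mod_eq_dvd_iff)
  then show ?thesis
    by (intro exI[of _ c] exI[of _ d]) (simp add: algebra_simps)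
qed

lemma sum_two_squares_plus_1_coprime:
  fixes m n :: int
  assumes "coprime m n" and "m dvd c * c + d * d + 1" and "n dvd c' * c' + d' * d' + 1"
  shows "\<exists>c d. m * n dvd c * c + d * d + 1"
proof -
  obtain u where u: "[u = c] (mod m)" "[u = c'] (mod n)"
    using binary_chinese_remainder_int[OF assms(1)] by blast
  obtain v where v: "[v = d] (mod m)" "[v = d'] (mod n)"
    using binary_chinese_remainder_int[OF assms(1)] by blast
  have "[u * u + v * v + 1 = c * c + d * d + 1] (mod m)"
    "[u * u + v * v + 1 = c' * c' + d' * d' + 1] (mod n)"
    using u v by (auto intro!: cong_add cong_mult)
  then have "m dvd u * u + v * v + 1" "n dvd u * u + v * v + 1"
    using assms(2,3) by (auto simp: cong_dvd_iff)
  then show ?thesis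
    using assms(1) by (blast intro: divides_mult)
qed

text \<open>
  The lifting step of Hensel's lemma: if \<open>c\<close> is a unit modulo \<open>p\<close>, then \<open>c\<close> can be changed by
  a multiple \<open>m t\<close> of \<open>m\<close> to gain one factor \<open>p\<close>. The term \<open>m\<^sup>2 t\<^sup>2\<close> does no harm because \<open>p\<close>
  divides \<open>m\<close>, and \<open>t\<close> exists because \<open>2 c\<close> is a unit modulo \<open>p\<close>.
\<close>

lemma sum_two_squares_plus_1_lift:
  fixes p m :: int
  assumes p: "prime p" "odd p" and pm: "p dvd m" and m: "m dvd c * c + d * d + 1" and c: "\<not> p dvd c"
  shows "\<exists>c. p * m dvd c * c + d * d + 1"
proof -
  obtain e where e: "c * c + d * d + 1 = m * e"
    using m ..
  obtain m' where m': "m = p * m'"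
    using pm ..
  have "\<not> p dvd 2"
    using p prime_gt_1_int[OF p(1)] zdvd_imp_le[of p 2] by (cases "p = 2") auto
  then have "coprime (2 * c) p"
    using p c by (metis coprime_commute prime_dvd_multD prime_imp_coprime)
  then obtain r where "[2 * c * r = 1] (mod p)"
    using cong_solve_coprime_int by blast
  then have "[2 * c * r * (- e) = 1 * (- e)] (mod p)"
    by (rule cong_mult) simp
  then have "p dvd e + 2 * c * (- e * r)"
    by (simp add: cong_iff_dvd_diff algebra_simps)
  then obtain s t where s: "e + 2 * c * t = p * s"
    by (blast elim: dvdE)
  have "(c + m * t) * (c + m * t) + d * d + 1 = m * (e + 2 * c * t + m * (t * t))"
    using e by (simp add: algebra_simps)
  also have "\<dots> = p * m * (s + m' * (t * t))"
    unfolding s by (simp add: m' algebra_simps)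
  finally show ?thesis
    by (metis dvd_triv_left)
qed

text \<open>
  Prime factors are added one at a time: a factor \<open>p\<close> not dividing the rest \<open>m\<close> by the Chinese
  remainder theorem, a repeated one by lifting. The hypothesis says that \<open>2\<close> is never repeated.
\<close>

lemma dvd_sum_two_squares_plus_1:
  fixes n :: nat
  assumes "\<not> 4 dvd n"
  shows "\<exists>c d. int n dvd c * c + d * d + 1"
  using assms
proof (induction n rule: prime_divisors_induct)
  case (factor p m)
  have p: "prime (int p)"
    using factor.hyps by simp
  have "\<not> 4 dvd m"
    using factor.prems by auto
  then obtain c d where cd: "int m dvd c * c + d * d + 1"
    using factor.IH by blast
  show ?case
  proof (cases "p dvd m")
    case False
    then have cop: "coprime (int p) (int m)"
      using factor.hyps by (simp add: prime_imp_coprime)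
    have "\<exists>c d. int p dvd c * c + d * d + 1"
    proof (cases "p = 2")
      case True
      then show ?thesis
        by (intro exI[of _ 1] exI[of _ 0]) simp
    next
      case False
      then have "odd p"
        using factor.hyps by (metis primes_dvd_imp_eq two_is_prime_nat)
      then show ?thesis
        using odd_prime_dvd_sum_two_squares_plus_1[OF p] by simp
    qed
    then show ?thesis
      using sum_two_squares_plus_1_coprime[OF cop _ cd] by auto
  next
    case True
    then have pm: "int p dvd int m"
      by simp
    have "p \<noteq> 2"
      using True factor.prems by auto
    then have odd: "odd (int p)"
      using factor.hyps by (metis even_of_nat primes_dvd_imp_eq two_is_prime_nat)
    have "int p dvd c * c + d * d + 1"
      using pm cd by (rule dvd_trans)
    \<comment> \<open>Otherwise \<open>p\<close> would divide \<open>1\<close>; the roles of \<open>c\<close> and \<open>d\<close> are symmetric.\<close>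
    then have "\<not> (int p dvd c \<and> int p dvd d)"
      using p by (metis dvd_add dvd_add_right_iff dvd_mult not_prime_unit)
    then consider "\<not> int p dvd c" | "\<not> int p dvd d"
      by blast
    then show ?thesis
    proof cases
      case 1
      then show ?thesis
        using sum_two_squares_plus_1_lift[OF p odd pm cd 1] unfolding of_nat_mult by blast
    next
      case 2
      have "int m dvd d * d + c * c + 1"
        using cd by (simp add: add.commute)
      then show ?thesis
        using sum_two_squares_plus_1_lift[OF p odd pm _ 2] unfolding of_nat_mult by blast
    qed
  qed
qed auto


section \<open>The classification\<close>

lemma hamilton_ring_ZFact_iso_split_quaternion_ring:
  fixes n :: nat
  assumes "\<not> 4 dvd n"
  shows "hamilton_ring (ZFact (int n)) \<simeq> split_quaternion_ring (ZFact (int n))"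
proof -
  obtain c d where "int n dvd c * c + d * d + 1"
    using dvd_sum_two_squares_plus_1[OF assms] by blast
  then show ?thesis
    by (intro cring.hamilton_ring_iso_split_quaternion_ring[OF ZFact_is_cring,
          of "ZMod (int n) c" _ "ZMod (int n) d"]) (simp_all add: ZFact_arith)
qed

theorem theorem1:
  fixes n :: nat
  assumes "n > 0"
  shows "(odd n \<longrightarrow>
           hamilton_ring (ZFact (int n)) \<simeq> split_quaternion_ring (ZFact (int n)) \<and>
           split_quaternion_ring (ZFact (int n)) \<simeq> matrix_ring (ZFact (int n)) 2) \<and>
         (n mod 4 = 2 \<longrightarrow>
           hamilton_ring (ZFact (int n)) \<simeq> split_quaternion_ring (ZFact (int n)) \<and>
           \<not> split_quaternion_ring (ZFact (int n)) \<simeq> matrix_ring (ZFact (int n)) 2) \<and>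
         (n mod 4 = 0 \<longrightarrow>
           \<not> hamilton_ring (ZFact (int n)) \<simeq> split_quaternion_ring (ZFact (int n)) \<and>
           \<not> hamilton_ring (ZFact (int n)) \<simeq> matrix_ring (ZFact (int n)) 2 \<and>
           \<not> split_quaternion_ring (ZFact (int n)) \<simeq> matrix_ring (ZFact (int n)) 2)"
proof -
  let ?R = "ZFact (int n)"
  interpret cring ?R
    by (rule ZFact_is_cring)
  have iso_HL: "hamilton_ring ?R \<simeq> split_quaternion_ring ?R" if "\<not> 4 dvd n"
    using that by (rule hamilton_ring_ZFact_iso_split_quaternion_ring)
  have iso_LM: "split_quaternion_ring ?R \<simeq> matrix_ring ?R 2" if "odd n"
    using that ZFact_half[of "int n"] split_quaternion_ring_iso_matrix_ring
    by (metis even_of_nat)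
  have not_iso_M: "\<not> quaternion_ring ?R a b \<simeq> matrix_ring ?R 2"
    if "even n" "a \<in> carrier ?R" "b \<in> carrier ?R" for a b
  proof (rule quaternion_ring_not_iso_matrix_ring)
    show "h \<oplus>\<^bsub>?R\<^esub> h \<noteq> \<one>\<^bsub>?R\<^esub>" if "h \<in> carrier ?R" for h
      using \<open>even n\<close> that by (simp add: ZFact_no_half)
  qed (use that in simp_all)
  have not_iso_HM: "\<not> hamilton_ring ?R \<simeq> matrix_ring ?R 2" if "even n"
    using not_iso_M that by (simp add: hamilton_ring_def)
  have not_iso_LM: "\<not> split_quaternion_ring ?R \<simeq> matrix_ring ?R 2" if "even n"
    using not_iso_M that by (simp add: split_quaternion_ring_def)
  have not_iso_HL: "\<not> hamilton_ring ?R \<simeq> split_quaternion_ring ?R" if "4 dvd n"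
  proof (rule hamilton_ring_not_iso_split_quaternion_ring)
    have "4 dvd int n"
      using that by presburger
    then show "\<exists>z\<in>carrier (split_quaternion_ring ?R).
        x = y \<oplus>\<^bsub>split_quaternion_ring ?R\<^esub> (z \<oplus>\<^bsub>split_quaternion_ring ?R\<^esub> z)"
      if "x \<in> carrier (split_quaternion_ring ?R)" "y \<in> carrier (split_quaternion_ring ?R)"
        "x \<otimes>\<^bsub>split_quaternion_ring ?R\<^esub> x \<oplus>\<^bsub>split_quaternion_ring ?R\<^esub> \<one>\<^bsub>split_quaternion_ring ?R\<^esub>
          = \<zero>\<^bsub>split_quaternion_ring ?R\<^esub>"
        "y \<otimes>\<^bsub>split_quaternion_ring ?R\<^esub> y \<oplus>\<^bsub>split_quaternion_ring ?R\<^esub> \<one>\<^bsub>split_quaternion_ring ?R\<^esub>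
          = \<zero>\<^bsub>split_quaternion_ring ?R\<^esub>" for x y
      using that by (intro ZFact_roots_minus_one_congruent)
    have "even (int n)"
      using that by presburger
    then show "h \<oplus>\<^bsub>?R\<^esub> h \<noteq> \<one>\<^bsub>?R\<^esub>" if "h \<in> carrier ?R" for h
      using that by (rule ZFact_no_half)
  qed
  have "odd n \<Longrightarrow> \<not> 4 dvd n" "n mod 4 = 2 \<Longrightarrow> \<not> 4 dvd n \<and> even n" "n mod 4 = 0 \<Longrightarrow> 4 dvd n \<and> even n"
    by presburger+
  with iso_HL iso_LM not_iso_HM not_iso_LM not_iso_HL show ?thesis
    by blast
qed

end
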